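(* Let $k\ge 1$ be a fixed integer and, for $n>k$, let $p_n=n-k$. For each $n>k$, let $z_1,\dots,z_{p_n}$ be the $p_n$ eigenvalues of the $p_n\times p_n$ upper-left submatrix of an $n\times n$ Haar-distributed unitary matrix; their joint density (with respect to Lebesgue measure on $\{z\in\mathbb{C}:|z|<1\}^{p_n}$) is $$C\prod_{1\le i<j\le p_n}|z_i-z_j|^2\prod_{j=1}^{p_n}(1-|z_j|^2)^{n-p_n-1},$$ where $C$ is a normalizing constant depending on $n$ and $p_n$. Then $$\frac{2n^{1+1/k}}{((k+1)!)^{1/k}}\Big(\max_{1\le j\le p_n}|z_j|-1\Big)$$ converges weakly, as $n\to\infty$, to the reversed Weibull distribution with cumulative distribution function $$W_k(x)=\begin{cases}\exp(-(-x)^k), & x\le 0,\\ 1, & x>0.\end{cases}$$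
   Context: A circular unitary matrix is an $n\times n$ random unitary matrix distributed according to Haar measure on the unitary group $U(n)$. Its truncation is the $p_n\times p_n$ submatrix obtained by deleting the last $n-p_n$ rows and columns. Weak convergence means convergence in distribution, i.e. pointwise convergence of the cumulative distribution functions at every continuity point of the limit. *)

theory Defs
  imports
    "HOL-Probability.Probability"
    "HOL-Combinatorics.Permutations"
    "Jordan_Normal_Form.Schur_Decomposition"
begin

definition unitary_group :: "nat \<Rightarrow> complex mat set" where
  "unitary_group n =
     {U \<in> carrier_mat n n. U * mat_adjoint U = 1\<^sub>m n \<and> mat_adjoint U * U = 1\<^sub>m n}"

(* The type of matrices carries no topology.  The sigma-algebra generated by the entries is
   the Borel sigma-algebra of U(n) as a subspace of the n x n complex matrices. *)
definition borel_unitary :: "nat \<Rightarrow> complex mat measure" where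
  "borel_unitary n =
     vimage_algebra (unitary_group n)
       (\<lambda>U. \<lambda>ij\<in>{..<n} \<times> {..<n}. U $$ ij)
       (\<Pi>\<^sub>M ij\<in>{..<n} \<times> {..<n}. (borel :: complex measure))"

(* U(n) is compact, so the left-invariant Borel probability measure is unique and is also
   right-invariant. *)
definition is_haar_unitary :: "nat \<Rightarrow> complex mat measure \<Rightarrow> bool" where
  "is_haar_unitary n \<mu> \<longleftrightarrow>
     prob_space \<mu> \<and> sets \<mu> = sets (borel_unitary n) \<and>
     (\<forall>V\<in>unitary_group n. \<forall>A\<in>sets \<mu>. emeasure \<mu> ((\<lambda>U. V * U) ` A) = emeasure \<mu> A)"

definition haar_distributed_unitary :: "'a measure \<Rightarrow> nat \<Rightarrow> ('a \<Rightarrow> complex mat) \<Rightarrow> bool" where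
  "haar_distributed_unitary M n U \<longleftrightarrow>
     U \<in> measurable M (borel_unitary n) \<and> is_haar_unitary n (distr M (borel_unitary n) U)"

definition truncation :: "nat \<Rightarrow> complex mat \<Rightarrow> complex mat" where
  "truncation p A = mat p p (\<lambda>ij. A $$ ij)"

(* z 1, ..., z p lists the eigenvalues of A with algebraic multiplicity. *)
definition enumerates_eigenvalues :: "complex mat \<Rightarrow> nat \<Rightarrow> (nat \<Rightarrow> complex) \<Rightarrow> bool" where
  "enumerates_eigenvalues A p z \<longleftrightarrow>
     A \<in> carrier_mat p p \<and> char_poly A = (\<Prod>j\<in>{1..p}. [:- z j, 1:])"

(* A joint density of p eigenvalues, symmetric in its arguments, describes the eigenvalues
   taken in no particular order.  A given measurable enumeration Z (for instance by decreasing
   modulus) need not be exchangeable, so the density is that of the vector obtained from Z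
   by an independent, uniformly distributed relabelling s. *)
definition has_unordered_joint_density ::
  "'a measure \<Rightarrow> nat \<Rightarrow> (nat \<Rightarrow> 'a \<Rightarrow> complex) \<Rightarrow> ((nat \<Rightarrow> complex) \<Rightarrow> real) \<Rightarrow> bool" where
  "has_unordered_joint_density M p Z f \<longleftrightarrow>
     distributed
       (M \<Otimes>\<^sub>M uniform_count_measure {s. s permutes {1..p}})
       (\<Pi>\<^sub>M j\<in>{1..p}. (lborel :: complex measure))
       (\<lambda>(\<omega>, s). \<lambda>j\<in>{1..p}. Z (s j) \<omega>)
       (\<lambda>x. ennreal (f x))"

(* The density, up to its constant, extended by 0 outside of the p-fold product of open unit
   discs. *)
definition truncated_unitary_weight :: "nat \<Rightarrow> nat \<Rightarrow> (nat \<Rightarrow> complex) \<Rightarrow> real" where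
  "truncated_unitary_weight n p z =
     (if \<forall>j\<in>{1..p}. cmod (z j) < 1
      then (\<Prod>j\<in>{1..p}. \<Prod>i\<in>{1..<j}. (cmod (z i - z j))\<^sup>2)
           * (\<Prod>j\<in>{1..p}. (1 - (cmod (z j))\<^sup>2) ^ (n - p - 1))
      else 0)"

definition reversed_weibull_cdf :: "nat \<Rightarrow> real \<Rightarrow> real" where
  "reversed_weibull_cdf k x = (if x \<le> 0 then exp (- ((- x) ^ k)) else 1)"

end

(* The density is invariant under rotation of each eigenvalue separately, up to the squared
   Vandermonde determinant. Expanding both Vandermonde factors over permutations, monomials
   z^a cnj(z)^b with a ~= b integrate to 0 against a radial weight, so only equal pairs of
   permutations survive. The probability that all eigenvalues lie in the disc of radius r is
   therefore the product over j < p of P(Beta(j + 1, k) <= r^2). With e = 1 - r^2, the upper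
   tails at 1 - e lie between (1 - n e) (j + k choose k) e^k and (j + k choose k) e^k, they are
   uniformly small, and they sum to (n choose k + 1) e^k in the limit, that is to (-x)^k for the
   given scaling; hence the product converges to exp (- (-x)^k). *)

theory Submission
  imports Defs
begin

text \<open>The constant \<open>C\<close> is never evaluated: the integral formula at radius 1
  normalises it, and the factors p! and pi^p cancel in the quotient. The result looks as if the
  squared moduli were independent Beta variables (Kostlan's phenomenon), although only the event
  that all moduli are at most r is treated. The density describes a randomly relabelled vector,
  while the maximum is taken over a given enumeration; the event is symmetric, so relabelling leaves
  its probability unchanged. The scaling is forced: for r = 1 + x / a, e = 1 - r^2 is about -2 x /
  a, so the 2 in a undoes the squaring of the radius, while n^(1 + 1/k) and ((k + 1)!)^(1/k) match
  the growth n^(k + 1) / (k + 1)! of (n choose k + 1). Uniform smallness of the tails q matters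
  because the sum of -log (1 - q) is then asymptotic to the sum of q.\<close>

section \<open>The Vandermonde determinant and its squared modulus\<close>

text \<open>Change from the monomial basis to the Newton polynomials \<open>N j\<close>. The
  coefficient matrix \<open>T\<close> is upper triangular with unit diagonal; the value matrix
  \<open>W\<close> is lower triangular, because \<open>N j\<close> vanishes at \<open>x i\<close>
  for \<open>i < j\<close>.\<close>

lemma det_vandermonde:
  fixes x :: "nat \<Rightarrow> 'a :: idom"
  shows "Determinant.det (mat n n (\<lambda>(i, j). x i ^ j)) = (\<Prod>i<n. \<Prod>l<i. x i - x l)"
proof -
  define N where "N j = (\<Prod>l<j. [:- x l, 1:])" for j :: nat
  define V where "V = mat n n (\<lambda>(i, j). x i ^ j)"
  define T where "T = mat n n (\<lambda>(i, j). coeff (N j) i)"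
  define W where "W = mat n n (\<lambda>(i, j). poly (N j) (x i))"
  have degree_N: "degree (N j) = j" and monic_N: "coeff (N j) j = 1" for j
  proof -
    show *: "degree (N j) = j"
      unfolding N_def by (subst degree_prod_eq_sum_degree) auto
    show "coeff (N j) j = 1"
      using monic_prod[of "{..<j}" "\<lambda>l. [:- x l, 1:]"] * unfolding N_def by simp
  qed
  have poly_N: "poly (N j) y = (\<Prod>l<j. y - x l)" for j y
    unfolding N_def by (simp add: poly_prod)
  have carrier: "V \<in> carrier_mat n n" "T \<in> carrier_mat n n" "W \<in> carrier_mat n n"
    by (simp_all add: V_def T_def W_def)
  have "V * T = W"
  proof (rule eq_matI)
    fix i j assume "i < dim_row W" "j < dim_col W"
    then have ij: "i < n" "j < n" by (simp_all add: W_def)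
    have "(V * T) $$ (i, j) = (\<Sum>m<n. x i ^ m * coeff (N j) m)"
      using ij by (simp add: V_def T_def scalar_prod_def atLeast0LessThan)
    also have "\<dots> = (\<Sum>m\<le>degree (N j). x i ^ m * coeff (N j) m)"
      using ij by (intro sum.mono_neutral_right) (auto simp: degree_N coeff_eq_0)
    also have "\<dots> = W $$ (i, j)"
      using ij by (simp add: W_def poly_altdef mult.commute)
    finally show "(V * T) $$ (i, j) = W $$ (i, j)" .
  qed (simp_all add: V_def T_def W_def)
  moreover have "Determinant.det T = 1"
  proof -
    have "Determinant.det T = prod_list (diag_mat T)"
      by (rule det_upper_triangular)
        (auto simp: T_def upper_triangular_def coeff_eq_0 degree_N)
    then show ?thesis by (simp add: prod_list_diag_prod T_def monic_N)
  qed
  moreover have "Determinant.det W = (\<Prod>i<n. \<Prod>l<i. x i - x l)"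
  proof -
    have "Determinant.det W = prod_list (diag_mat W)"
      by (rule det_lower_triangular[of n]) (auto simp: W_def poly_N intro!: prod_zero)
    then show ?thesis by (simp add: prod_list_diag_prod W_def poly_N atLeast0LessThan)
  qed
  ultimately show ?thesis
    using det_mult[OF carrier(1,2)] by (simp add: V_def)
qed

text \<open>The squared modulus is the determinant times its conjugate, each expanded by the Leibniz
  formula. Every term is then a product of one-variable functions, ready for Fubini.\<close>

lemma norm_vandermonde_sq:
  fixes x :: "nat \<Rightarrow> complex"
  shows "complex_of_real (\<Prod>i<n. \<Prod>l<i. (cmod (x l - x i))\<^sup>2) =
    (\<Sum>\<sigma> | \<sigma> permutes {..<n}. \<Sum>\<tau> | \<tau> permutes {..<n}.
       signof \<sigma> * signof \<tau> * (\<Prod>i<n. x i ^ \<sigma> i * cnj (x i) ^ \<tau> i))"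
proof -
  define V where "V = mat n n (\<lambda>(i, j). x i ^ j)"
  have det_V: "Determinant.det V = (\<Sum>\<sigma> | \<sigma> permutes {..<n}. signof \<sigma> * (\<Prod>i<n. x i ^ \<sigma> i))"
  proof -
    have "Determinant.det V = (\<Sum>\<sigma> | \<sigma> permutes {0..<n}. signof \<sigma> * (\<Prod>i = 0..<n. V $$ (i, \<sigma> i)))"
      by (rule det_def') (simp add: V_def)
    also have "\<dots> = (\<Sum>\<sigma> | \<sigma> permutes {0..<n}. signof \<sigma> * (\<Prod>i = 0..<n. x i ^ \<sigma> i))"
    proof (intro sum.cong refl arg_cong2[where f = "(*)"] prod.cong)
      fix \<sigma> i assume "\<sigma> \<in> {\<sigma>. \<sigma> permutes {0..<n}}" "i \<in> {0..<n}"
      then have "\<sigma> i < n" using permutes_in_image[of \<sigma> "{0..<n}" i] by auto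
      then show "V $$ (i, \<sigma> i) = x i ^ \<sigma> i" using \<open>i \<in> {0..<n}\<close> by (simp add: V_def)
    qed
    finally show ?thesis by (simp add: atLeast0LessThan)
  qed
  have "complex_of_real (\<Prod>i<n. \<Prod>l<i. (cmod (x l - x i))\<^sup>2) = of_real ((cmod (Determinant.det V))\<^sup>2)"
    unfolding V_def det_vandermonde
    by (simp add: prod_norm[symmetric] prod_power_distrib norm_minus_commute)
  also have "\<dots> = Determinant.det V * cnj (Determinant.det V)"
    by (rule complex_norm_square)
  also have "cnj (Determinant.det V) = (\<Sum>\<tau> | \<tau> permutes {..<n}. signof \<tau> * (\<Prod>i<n. cnj (x i) ^ \<tau> i))"
    unfolding det_V cnj_sum by (intro sum.cong refl) (auto simp: sign_def)
  also have "Determinant.det V * \<dots> = (\<Sum>\<sigma> | \<sigma> permutes {..<n}. \<Sum>\<tau> | \<tau> permutes {..<n}.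
       signof \<sigma> * signof \<tau> * (\<Prod>i<n. x i ^ \<sigma> i * cnj (x i) ^ \<tau> i))"
    unfolding det_V sum_product by (simp add: prod.distrib mult_ac)
  finally show ?thesis .
qed

section \<open>Rotation invariance of Lebesgue measure on the complex plane\<close>

text \<open>Integrate the sheared coordinate first: for a fixed value of the other one, the shear is
  a translation.\<close>

lemma nn_integral_lborel_shear:
  fixes f :: "real \<times> real \<Rightarrow> ennreal"
  assumes [measurable]: "f \<in> borel_measurable borel"
  shows "(\<integral>\<^sup>+w. f (fst w + t * snd w, snd w) \<partial>lborel) = (\<integral>\<^sup>+w. f w \<partial>lborel)"
    and "(\<integral>\<^sup>+w. f (fst w, snd w + t * fst w) \<partial>lborel) = (\<integral>\<^sup>+w. f w \<partial>lborel)"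
proof -
  have shift: "(\<integral>\<^sup>+x. g (x + c) \<partial>lborel) = (\<integral>\<^sup>+x. g x \<partial>lborel)"
    if "g \<in> borel_measurable borel" for g :: "real \<Rightarrow> ennreal" and c
    using nn_integral_real_affine[OF that, of 1 c] by (simp add: add.commute)
  have [measurable]: "f \<in> borel_measurable (borel \<Otimes>\<^sub>M borel)"
    using assms by (simp add: borel_prod)
  have "(\<integral>\<^sup>+w. f (fst w + t * snd w, snd w) \<partial>lborel) =
    (\<integral>\<^sup>+w. f (fst w + t * snd w, snd w) \<partial>(lborel \<Otimes>\<^sub>M lborel))"
    by (simp add: lborel_prod)
  also have "\<dots> = (\<integral>\<^sup>+y. \<integral>\<^sup>+x. f (x + t * y, y) \<partial>lborel \<partial>lborel)"
    by (subst lborel_pair.nn_integral_snd[symmetric]) (auto simp: split_beta')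
  also have "\<dots> = (\<integral>\<^sup>+y. \<integral>\<^sup>+x. f (x, y) \<partial>lborel \<partial>lborel)"
    by (intro nn_integral_cong shift) measurable
  also have "\<dots> = (\<integral>\<^sup>+w. f w \<partial>(lborel \<Otimes>\<^sub>M lborel))"
    by (subst lborel_pair.nn_integral_snd[symmetric]) (auto simp: split_beta')
  finally show "(\<integral>\<^sup>+w. f (fst w + t * snd w, snd w) \<partial>lborel) = (\<integral>\<^sup>+w. f w \<partial>lborel)"
    by (simp add: lborel_prod)
  have "(\<integral>\<^sup>+w. f (fst w, snd w + t * fst w) \<partial>lborel) =
    (\<integral>\<^sup>+w. f (fst w, snd w + t * fst w) \<partial>(lborel \<Otimes>\<^sub>M lborel))"
    by (simp add: lborel_prod)
  also have "\<dots> = (\<integral>\<^sup>+x. \<integral>\<^sup>+y. f (x, y + t * x) \<partial>lborel \<partial>lborel)"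
    by (subst lborel.nn_integral_fst[symmetric]) (auto simp: split_beta')
  also have "\<dots> = (\<integral>\<^sup>+x. \<integral>\<^sup>+y. f (x, y) \<partial>lborel \<partial>lborel)"
    by (intro nn_integral_cong shift) measurable
  also have "\<dots> = (\<integral>\<^sup>+w. f w \<partial>(lborel \<Otimes>\<^sub>M lborel))"
    by (subst lborel.nn_integral_fst[symmetric]) (auto simp: split_beta')
  finally show "(\<integral>\<^sup>+w. f (fst w, snd w + t * fst w) \<partial>lborel) = (\<integral>\<^sup>+w. f w \<partial>lborel)"
    by (simp add: lborel_prod)
qed

text \<open>Transfers Fubini from pairs of reals to the complex plane. Boxes suffice because their
  volumes characterise Lebesgue measure.\<close>

lemma lborel_complex_eq_distr:
  "(lborel :: complex measure) = distr lborel borel (\<lambda>w. Complex (fst w) (snd w))"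
proof (rule lborel_eqI)
  have cont: "continuous_on UNIV (\<lambda>w::real \<times> real. Complex (fst w) (snd w))"
    by (intro continuous_intros)
  then have meas: "(\<lambda>w::real \<times> real. Complex (fst w) (snd w)) \<in> borel_measurable borel"
    by (rule borel_measurable_continuous_onI)
  fix l u :: complex assume le: "\<And>b. b \<in> Basis \<Longrightarrow> l \<bullet> b \<le> u \<bullet> b"
  have le': "Re l \<le> Re u" "Im l \<le> Im u"
    using le[of 1] le[of \<i>] by (simp_all add: Basis_complex_def)
  have "(\<lambda>w::real \<times> real. Complex (fst w) (snd w)) -` box l u = {Re l<..<Re u} \<times> {Im l<..<Im u}"
    by (auto simp: box_def Basis_complex_def)
  then have "emeasure (distr lborel borel (\<lambda>w. Complex (fst w) (snd w))) (box l u)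
    = emeasure (lborel \<Otimes>\<^sub>M lborel) ({Re l<..<Re u} \<times> {Im l<..<Im u})"
    using meas by (subst emeasure_distr) (simp_all add: lborel_prod)
  also have "\<dots> = ennreal ((Re u - Re l) * (Im u - Im l))"
    using le' by (subst lborel.emeasure_pair_measure_Times) (simp_all add: ennreal_mult)
  also have "\<dots> = ennreal (\<Prod>b\<in>Basis. (u - l) \<bullet> b)"
    by (simp add: Basis_complex_def)
  finally show "emeasure (distr lborel borel (\<lambda>w. Complex (fst w) (snd w))) (box l u) =
    ennreal (\<Prod>b\<in>Basis. (u - l) \<bullet> b)" .
qed simp

text \<open>A rotation other than the half turn is a product of three shears.\<close>

lemma lborel_distr_rotation:
  assumes "cmod u = 1" "u \<noteq> - 1"
  shows "distr lborel borel ((*) u) = lborel"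
proof (rule measure_eqI)
  fix A assume A: "A \<in> sets (distr lborel borel ((*) u))"
  \<comment> \<open>For \<open>u\<close> = cos \<theta> + i sin \<theta>, \<open>t\<close> is - tan
    (\<theta> / 2). Shearing x by \<open>t\<close>, then y by \<open>s\<close>, then x by
    \<open>t\<close> gives the rotation; at the half turn the denominator \<open>1 + c\<close>
    vanishes.\<close>
  define s c t where "s = Im u" and "c = Re u" and "t = - s / (1 + c)"
  have sc: "s\<^sup>2 + c\<^sup>2 = 1"
    using cmod_power2[of u] assms(1) by (simp add: s_def c_def)
  have "1 + c \<noteq> 0"
  proof
    assume "1 + c = 0"
    then have "c = -1" by simp
    with sc have "s = 0" by simp
    with \<open>c = -1\<close> assms(2) show False by (auto simp: s_def c_def complex_eq_iff)
  qed
  then have t1: "1 + s * t = c" and t2: "t * (1 + c) = - s"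
    using sc by (simp_all add: t_def field_simps power2_eq_square)
  define K where "K w = Complex (fst w) (snd w)" for w
  have [measurable]: "K \<in> borel_measurable borel"
    unfolding K_def by (intro borel_measurable_continuous_onI continuous_intros)
  have lborel_K: "lborel = distr lborel borel K"
    unfolding K_def[abs_def] by (rule lborel_complex_eq_distr)
  have [measurable]: "A \<in> sets borel" using A by simp
  define f :: "real \<times> real \<Rightarrow> ennreal" where "f w = indicator A (K w)" for w
  have [measurable]: "f \<in> borel_measurable borel"
    unfolding f_def by measurable
  have rot: "f (fst w + t * snd w + t * (snd w + s * (fst w + t * snd w)), snd w + s * (fst w + t * snd w))
      = indicator A (u * K w)" for w
  proof -
    have 1: "snd w + s * (fst w + t * snd w) = s * fst w + c * snd w"
      unfolding t1[symmetric] by (simp add: algebra_simps)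
    have "fst w + t * snd w + t * (s * fst w + c * snd w) = (1 + s * t) * fst w + (t * (1 + c)) * snd w"
      by (simp add: algebra_simps)
    also have "\<dots> = c * fst w - s * snd w" unfolding t1 t2 by simp
    finally show ?thesis unfolding 1 f_def K_def
      by (auto intro!: arg_cong[where f = "indicator A"] simp: complex_eq_iff s_def c_def)
  qed
  have meas1: "(\<lambda>w. f (fst w + t * snd w, snd w)) \<in> borel_measurable borel"
    by (rule measurable_compose[OF _ \<open>f \<in> borel_measurable borel\<close>])
      (intro borel_measurable_continuous_onI continuous_intros)
  have meas2: "(\<lambda>w. f (fst w + t * (snd w + s * fst w), snd w + s * fst w)) \<in> borel_measurable borel"
    by (rule measurable_compose[OF _ \<open>f \<in> borel_measurable borel\<close>])
      (intro borel_measurable_continuous_onI continuous_intros)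
  have "emeasure (distr lborel borel ((*) u)) A = (\<integral>\<^sup>+z. indicator A (u * z) \<partial>lborel)"
    by (subst nn_integral_distr[of "(*) u" lborel borel "indicator A", symmetric]) (auto simp: A)
  also have "\<dots> = (\<integral>\<^sup>+w. indicator A (u * K w) \<partial>lborel)"
    by (subst lborel_K, subst nn_integral_distr) auto
  also have "\<dots> = (\<integral>\<^sup>+w. f w \<partial>lborel)"
    \<comment> \<open>The shears are peeled off from the outermost inwards: each application
      precomposes the previous integrand with one more shear.\<close>
    using nn_integral_lborel_shear(1)[OF \<open>f \<in> borel_measurable borel\<close>, of t]
      nn_integral_lborel_shear(2)[OF meas1, of s] nn_integral_lborel_shear(1)[OF meas2, of t]
    by (simp add: rot)
  also have "\<dots> = (\<integral>\<^sup>+z. indicator A z \<partial>distr lborel borel K)"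
    by (subst nn_integral_distr) (auto simp: f_def[abs_def])
  also have "\<dots> = (\<integral>\<^sup>+z. indicator A z \<partial>lborel)"
    by (simp flip: lborel_K)
  finally show "emeasure (distr lborel borel ((*) u)) A = emeasure lborel A"
    by simp
qed simp

text \<open>Replacing z by \<open>u * z\<close> with \<open>cmod u = 1\<close> preserves the
  integral but multiplies it by \<open>u ^ a * cnj u ^ b\<close>. A suitable \<open>u\<close> makes
  this factor differ from 1.\<close>

lemma integral_radial_monomial_eq_0:
  fixes g :: "real \<Rightarrow> complex"
  assumes "a \<noteq> b"
  assumes [measurable]: "g \<in> borel_measurable borel"
  shows "(LINT z|lborel. z ^ a * cnj z ^ b * g (cmod z)) = 0"
proof -
  define d where "d = (if a > b then a - b else b - a)"
  have "d > 0" using assms(1) by (auto simp: d_def)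
  \<comment> \<open>The angle is chosen so that \<open>u ^ d\<close> is the imaginary unit, which
    makes the factor i or -i. Aiming at -1 instead would yield the excluded half turn when
    \<open>d = 1\<close>.\<close>
  define u where "u = cis (pi / (2 * real d))"
  have u: "cmod u = 1" by (simp add: u_def)
  have "pi / (2 * real d) \<le> pi / 2"
    using \<open>d > 0\<close> by (intro divide_left_mono) auto
  moreover have "pi / (2 * real d) > 0" using \<open>d > 0\<close> by simp
  ultimately have "cos (pi / (2 * real d)) \<ge> 0"
    by (intro cos_ge_zero) auto
  then have "u \<noteq> -1" by (auto simp: u_def complex_eq_iff)
  have "u ^ d = cis (real d * (pi / (2 * real d)))"
    unfolding u_def by (rule Complex.DeMoivre)
  also have "\<dots> = \<i>" using \<open>d > 0\<close> by simp
  finally have ud: "u ^ d = \<i>" .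
  have uu: "u ^ m * cnj u ^ m = 1" for m
    using u by (simp add: power_mult_distrib[symmetric] complex_norm_square[symmetric])
  have ne: "u ^ a * cnj u ^ b \<noteq> 1"
  proof (cases "a > b")
    case True
    then have "a = b + d" by (simp add: d_def)
    then have "u ^ a * cnj u ^ b = (u ^ b * cnj u ^ b) * u ^ d" by (simp add: power_add)
    then show ?thesis by (simp add: uu ud complex_eq_iff)
  next
    case False
    then have "b = a + d" by (simp add: d_def)
    then have "u ^ a * cnj u ^ b = (u ^ a * cnj u ^ a) * cnj (u ^ d)" by (simp add: power_add)
    then show ?thesis by (simp add: uu ud complex_eq_iff)
  qed
  have [measurable]: "cnj \<in> borel_measurable borel"
    by (intro borel_measurable_continuous_onI continuous_intros)
  let ?f = "\<lambda>z. z ^ a * cnj z ^ b * g (cmod z)"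
  have "(LINT z|lborel. ?f z) = (LINT z|distr lborel borel ((*) u). ?f z)"
    using lborel_distr_rotation[OF u \<open>u \<noteq> -1\<close>] by simp
  also have "\<dots> = (LINT z|lborel. ?f (u * z))"
    by (rule integral_distr) measurable
  also have "\<dots> = (LINT z|lborel. (u ^ a * cnj u ^ b) * ?f z)"
    by (simp add: norm_mult u power_mult_distrib mult_ac)
  \<comment> \<open>Valid for non-integrable integrands too, since their Bochner integral is
    0.\<close>
  also have "\<dots> = (u ^ a * cnj u ^ b) * (LINT z|lborel. ?f z)"
    by (rule integral_mult_right_zero)
  finally show ?thesis using ne by (simp add: mult_cancel_right1)
qed

section \<open>Reduction of radial integrals to one real variable\<close>

text \<open>Polar coordinates in the variable t = |z|^2: the disc of radius sqrt a has area pi a,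
  linear in a, so the density is constant on the half-line. The sets \<open>{..a}\<close> are closed
  under intersection and generate the Borel sets.\<close>

lemma lborel_distr_norm_sq:
  "distr (lborel :: complex measure) borel (\<lambda>z. (cmod z)\<^sup>2) =
   density lborel (\<lambda>t. ennreal pi * indicator {0..} t)"
proof (rule measure_eqI_generator_eq)
  let ?E = "range (\<lambda>a::real. {..a})"
  show "Int_stable ?E" by (auto simp: Int_stable_def)
  show "sets (distr (lborel :: complex measure) borel (\<lambda>z. (cmod z)\<^sup>2)) = sigma_sets UNIV ?E"
    by (simp add: borel_eq_atMost)
  show "sets (density lborel (\<lambda>t::real. ennreal pi * indicator {0..} t)) = sigma_sets UNIV ?E"
    by (simp add: borel_eq_atMost)
  have 1: "emeasure (distr (lborel :: complex measure) borel (\<lambda>z. (cmod z)\<^sup>2)) {..a} = ennreal (pi * max 0 a)"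
    for a :: real
  proof -
    have "emeasure (distr (lborel :: complex measure) borel (\<lambda>z. (cmod z)\<^sup>2)) {..a} =
      emeasure lborel {z :: complex. (cmod z)\<^sup>2 \<le> a}"
      by (subst emeasure_distr) (auto intro!: arg_cong[where f = "emeasure lborel"])
    also have "\<dots> = ennreal (pi * max 0 a)"
    proof (cases "a \<ge> 0")
      case True
      then have "{z :: complex. (cmod z)\<^sup>2 \<le> a} = cball 0 (sqrt a)"
        using real_le_rsqrt real_sqrt_ge_zero by (auto simp: real_le_rsqrt sqrt_le_D)
          (metis norm_ge_zero power_mono real_sqrt_pow2)
      then show ?thesis using True by (simp add: emeasure_cball unit_ball_vol_2)
    next
      case False
      then have "{z :: complex. (cmod z)\<^sup>2 \<le> a} = {}"
        using order_trans[OF zero_le_power2] by auto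
      then show ?thesis using False by simp
    qed
    finally show ?thesis .
  qed
  have 2: "emeasure (density lborel (\<lambda>t::real. ennreal pi * indicator {0..} t)) {..a} = ennreal (pi * max 0 a)"
    for a :: real
  proof -
    have "emeasure (density lborel (\<lambda>t::real. ennreal pi * indicator {0..} t)) {..a} =
      (\<integral>\<^sup>+t. ennreal pi * indicator {0..a} t \<partial>lborel)"
      by (subst emeasure_density) (auto intro!: nn_integral_cong simp: indicator_def)
    also have "\<dots> = ennreal (pi * max 0 a)"
      by (subst nn_integral_cmult) (auto simp: ennreal_mult max_def)
    finally show ?thesis .
  qed
  show "emeasure (distr (lborel :: complex measure) borel (\<lambda>z. (cmod z)\<^sup>2)) X =
    emeasure (density lborel (\<lambda>t::real. ennreal pi * indicator {0..} t)) X" if "X \<in> ?E" for X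
    using that 1 2 by auto
  show "range (\<lambda>i. {..real i}) \<subseteq> ?E" by auto
  show "(\<Union>i. {..real i}) = UNIV" using real_arch_simple by auto
  show "emeasure (distr (lborel :: complex measure) borel (\<lambda>z. (cmod z)\<^sup>2)) {..real i} \<noteq> \<infinity>" for i
    by (simp add: 1)
qed auto

lemma integral_norm_sq:
  fixes h :: "real \<Rightarrow> real"
  assumes [measurable]: "h \<in> borel_measurable borel"
  shows "(LINT z|(lborel :: complex measure). h ((cmod z)\<^sup>2)) = pi * (LINT t:{0..}|lborel. h t)"
proof -
  have "(LINT z|(lborel :: complex measure). h ((cmod z)\<^sup>2)) =
    (LINT t|distr (lborel :: complex measure) borel (\<lambda>z. (cmod z)\<^sup>2). h t)"
    by (rule integral_distr[symmetric]) measurable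
  also have "\<dots> = (LINT t|density lborel (\<lambda>t. ennreal (pi * indicator {0..} t)). h t)"
    unfolding lborel_distr_norm_sq
    by (intro arg_cong2[where f = "lebesgue_integral"] arg_cong2[where f = density] refl ext)
      (simp add: indicator_def)
  also have "\<dots> = (LINT t|lborel. (pi * indicator {0..} t) *\<^sub>R h t)"
    by (rule integral_density) auto
  also have "\<dots> = pi * (LINT t:{0..}|lborel. h t)"
    by (simp add: set_lebesgue_integral_def mult.assoc)
  finally show ?thesis .
qed

section \<open>The squared Vandermonde determinant against a radial product weight\<close>

text \<open>Each of the p! diagonal pairs of permutations contributes the same product of even
  moments, since a permutation only reorders the factors. Odd moments enter the integrability
  hypothesis because a monomial with exponents a and b has modulus |z|^(a + b).\<close>

lemma vandermonde_radial_integral: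
  fixes g :: "real \<Rightarrow> real" and p :: nat
  assumes [measurable]: "g \<in> borel_measurable borel"
  assumes integrable: "\<And>m. integrable lborel (\<lambda>z::complex. cmod z ^ m * g (cmod z))"
  defines "P \<equiv> \<Pi>\<^sub>M j\<in>{1..p}. (lborel :: complex measure)"
  defines "w \<equiv> (\<lambda>x. (\<Prod>j\<in>{1..p}. \<Prod>i\<in>{1..<j}. (cmod (x i - x j))\<^sup>2) * (\<Prod>j\<in>{1..p}. g (cmod (x j))))"
  shows "integrable P w"
    and "(LINT x|P. w x) = fact p * (\<Prod>i<p. LINT z|(lborel :: complex measure). cmod z ^ (2 * i) * g (cmod z))"
proof -
  interpret product_sigma_finite "\<lambda>_::nat. lborel :: complex measure" ..
  define S where "S = {\<sigma>. \<sigma> permutes {..<p}}"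
  have finS: "finite S" unfolding S_def by (simp add: finite_permutations)
  define \<phi> where "\<phi> a b z = z ^ a * cnj z ^ b * of_real (g (cmod z))" for a b :: nat and z
  define m where "m i = (LINT z|(lborel :: complex measure). cmod z ^ (2 * i) * g (cmod z))" for i
  \<comment> \<open>Coordinates run over \<open>{1..p}\<close> but exponents over
    \<open>{..<p}\<close>, hence the shift by one.\<close>
  define G where "G \<sigma> \<tau> x = (\<Prod>j\<in>{1..p}. \<phi> (\<sigma> (j - 1)) (\<tau> (j - 1)) (x j))" for \<sigma> \<tau> :: "nat \<Rightarrow> nat" and x
  have [measurable]: "cnj \<in> borel_measurable borel"
    by (intro borel_measurable_continuous_onI continuous_intros)
  have integrable_\<phi>: "integrable lborel (\<phi> a b)" for a b
  proof (rule Bochner_Integration.integrable_bound[OF integrable[of "a + b"]])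
    show "\<phi> a b \<in> borel_measurable lborel" unfolding \<phi>_def by measurable
  qed (simp add: \<phi>_def norm_mult norm_power power_add abs_mult)
  have integral_\<phi>: "(LINT z|lborel. \<phi> a b z) = (if a = b then of_real (m a) else 0)" for a b
  proof (cases "a = b")
    case True
    have "\<phi> a a = (\<lambda>z. of_real (cmod z ^ (2 * a) * g (cmod z)))"
    proof
      fix z
      have "z ^ a * cnj z ^ a = of_real ((cmod z)\<^sup>2) ^ a"
        unfolding complex_norm_square by (simp add: power_mult_distrib)
      then show "\<phi> a a z = of_real (cmod z ^ (2 * a) * g (cmod z))"
        by (simp add: \<phi>_def power_mult)
    qed
    then show ?thesis using True by (simp add: m_def integral_complex_of_real del: of_real_mult of_real_power)
  next
    case False
    then show ?thesis unfolding \<phi>_def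
      using integral_radial_monomial_eq_0[OF False, of "\<lambda>y. of_real (g y)"] by simp
  qed
  have integrable_G: "integrable P (G \<sigma> \<tau>)" for \<sigma> \<tau>
    unfolding G_def P_def by (intro product_integrable_prod integrable_\<phi>) auto
  have integral_G: "(LINT x|P. G \<sigma> \<tau> x) = (if \<sigma> = \<tau> then of_real (\<Prod>i<p. m i) else 0)"
    if "\<sigma> \<in> S" "\<tau> \<in> S" for \<sigma> \<tau>
  proof -
    have "(LINT x|P. G \<sigma> \<tau> x) = (\<Prod>j\<in>{1..p}. LINT z|lborel. \<phi> (\<sigma> (j - 1)) (\<tau> (j - 1)) z)"
      unfolding G_def P_def by (intro product_integral_prod integrable_\<phi>) auto
    also have "\<dots> = (\<Prod>i<p. if \<sigma> i = \<tau> i then of_real (m (\<sigma> i)) else 0)"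
      unfolding integral_\<phi> by (simp add: prod.atLeast1_atMost_eq cong: if_cong)
    also have "\<dots> = (if \<sigma> = \<tau> then of_real (\<Prod>i<p. m i) else 0)"
    proof (cases "\<sigma> = \<tau>")
      case True
      have "(\<Prod>i<p. m (\<sigma> i)) = (\<Prod>i<p. m i)"
        using prod.permute[of \<sigma> "{..<p}" m] that by (simp add: S_def o_def)
      then show ?thesis using True by (simp flip: of_real_prod)
    next
      case False
      \<comment> \<open>Two permutations of \<open>{..<p}\<close> agree outside it, so they differ
        at some index below \<open>p\<close>; its factor annihilates the product.\<close>
      then obtain i where i: "\<sigma> i \<noteq> \<tau> i" by auto
      then have "i < p" using that unfolding S_def
        by (metis lessThan_iff mem_Collect_eq permutes_not_in)
      then show ?thesis using False i by (auto intro!: prod_zero)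
    qed
    finally show ?thesis .
  qed
  have w_eq: "of_real (w x) = (\<Sum>\<sigma>\<in>S. \<Sum>\<tau>\<in>S. signof \<sigma> * signof \<tau> * G \<sigma> \<tau> x)" for x
  proof -
    have "(\<Prod>j\<in>{1..p}. \<Prod>i\<in>{1..<j}. (cmod (x i - x j))\<^sup>2) = (\<Prod>j<p. \<Prod>i<j. (cmod (x (Suc i) - x (Suc j)))\<^sup>2)"
      by (simp only: prod.atLeast1_atMost_eq prod.atLeast_Suc_lessThan_Suc_shift One_nat_def)
        (simp add: atLeast0LessThan)
    then have "of_real (w x) =
      complex_of_real (\<Prod>j<p. \<Prod>i<j. (cmod (x (Suc i) - x (Suc j)))\<^sup>2) * of_real (\<Prod>i<p. g (cmod (x (Suc i))))"
      unfolding w_def by (simp only: of_real_mult prod.atLeast1_atMost_eq One_nat_def)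
    also have "\<dots> = (\<Sum>\<sigma>\<in>S. \<Sum>\<tau>\<in>S. signof \<sigma> * signof \<tau> * G \<sigma> \<tau> x)"
      unfolding norm_vandermonde_sq S_def G_def One_nat_def prod.atLeast1_atMost_eq sum_distrib_right
      by (simp add: \<phi>_def prod.distrib mult.assoc)
    finally show ?thesis .
  qed
  have "integrable P (\<lambda>x. complex_of_real (w x))"
    unfolding w_eq by (intro Bochner_Integration.integrable_sum integrable_mult_right integrable_G)
  then show "integrable P w" by (simp only: complex_of_real_integrable_eq)
  have "complex_of_real (LINT x|P. w x) = (LINT x|P. of_real (w x))"
    by (rule integral_complex_of_real[symmetric])
  also have "\<dots> = (\<Sum>\<sigma>\<in>S. \<Sum>\<tau>\<in>S. signof \<sigma> * signof \<tau> * (LINT x|P. G \<sigma> \<tau> x))"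
    unfolding w_eq
  proof (subst Bochner_Integration.integral_sum)
    show "integrable P (\<lambda>x. \<Sum>\<tau>\<in>S. signof \<sigma> * signof \<tau> * G \<sigma> \<tau> x)" for \<sigma>
      by (intro Bochner_Integration.integrable_sum integrable_mult_right integrable_G)
    show "(\<Sum>\<sigma>\<in>S. LINT x|P. (\<Sum>\<tau>\<in>S. signof \<sigma> * signof \<tau> * G \<sigma> \<tau> x))
      = (\<Sum>\<sigma>\<in>S. \<Sum>\<tau>\<in>S. signof \<sigma> * signof \<tau> * (LINT x|P. G \<sigma> \<tau> x))"
    proof (intro sum.cong refl)
      fix \<sigma>
      show "(LINT x|P. (\<Sum>\<tau>\<in>S. signof \<sigma> * signof \<tau> * G \<sigma> \<tau> x))
        = (\<Sum>\<tau>\<in>S. signof \<sigma> * signof \<tau> * (LINT x|P. G \<sigma> \<tau> x))"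
        by (subst Bochner_Integration.integral_sum)
          (auto intro!: integrable_mult_right integrable_G sum.cong integral_mult_right_zero)
    qed
  qed
  also have "\<dots> = (\<Sum>\<sigma>\<in>S. \<Sum>\<tau>\<in>S. if \<sigma> = \<tau> then of_real (\<Prod>i<p. m i) else 0)"
    by (intro sum.cong refl) (auto simp: integral_G sign_def)
  also have "\<dots> = of_real (fact p * (\<Prod>i<p. m i))"
    using finS by (simp add: S_def card_permutations)
  finally show "(LINT x|P. w x) = fact p * (\<Prod>i<p. LINT z|(lborel :: complex measure). cmod z ^ (2 * i) * g (cmod z))"
    unfolding m_def by (simp only: of_real_eq_iff)
qed

section \<open>Beta integrals and their upper tails\<close>

lemma integral_one_minus_power:
  fixes s :: real
  assumes "s \<le> 1" "k \<ge> 1"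
  shows "((\<lambda>t. (1 - t) ^ (k - 1)) has_integral (1 - s) ^ k / k) {s..1}"
proof -
  have "((\<lambda>t. (1 - t) ^ (k - 1)) has_integral (- ((1 - 1) ^ k / k)) - (- ((1 - s) ^ k / k))) {s..1}"
  proof (rule fundamental_theorem_of_calculus)
    show "((\<lambda>t. - ((1 - t) ^ k / k)) has_vector_derivative (1 - t) ^ (k - 1)) (at t within {s..1})" for t
      unfolding has_real_derivative_iff_has_vector_derivative[symmetric]
      using assms(2) by (auto intro!: derivative_eq_intros)
  qed (use assms in auto)
  then show ?thesis using assms(2) by (simp add: power_0_left)
qed

text \<open>The unnormalised upper incomplete Beta integral with parameters \<open>j + 1\<close> and
  \<open>k\<close>; for \<open>k \<ge> 1\<close>, dividing by its value at 0 gives the probability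
  that a Beta variable exceeds \<open>s\<close>.\<close>

definition beta_tail :: "nat \<Rightarrow> nat \<Rightarrow> real \<Rightarrow> real" where
  "beta_tail k j s = integral {s..1} (\<lambda>t. t ^ j * (1 - t) ^ (k - 1))"

lemma beta_integrand_integrable:
  "(\<lambda>t::real. t ^ j * (1 - t) ^ (k - 1)) integrable_on {a..b}"
  by (intro integrable_continuous_interval continuous_intros)

text \<open>The complete integral is B(j + 1, k) = j! (k - 1)! / (j + k)!. Its reciprocal is the
  source of the binomial coefficients in the tail bounds.\<close>

lemma beta_tail_0:
  assumes "k \<ge> 1"
  shows "beta_tail k j 0 = 1 / (k * real ((j + k) choose k))"
proof -
  have "((\<lambda>t. t powr (real (j + 1) - 1) * (1 - t) powr (real k - 1)) has_integral Beta (real (j + 1)) (real k)) {0..1}"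
    by (rule has_integral_Beta_real) (use assms in auto)
  \<comment> \<open>The endpoints are removed because \<open>0 powr 0 = 0\<close> whereas
    \<open>0 ^ 0 = 1\<close>.\<close>
  then have "((\<lambda>t. t powr (real (j + 1) - 1) * (1 - t) powr (real k - 1)) has_integral Beta (real (j + 1)) (real k)) {0<..<1}"
    by (simp add: has_integral_Icc_iff_Ioo)
  also have "?this \<longleftrightarrow> ((\<lambda>t. t ^ j * (1 - t) ^ (k - 1)) has_integral Beta (real (j + 1)) (real k)) {0<..<1}"
    by (intro has_integral_cong) (use assms in \<open>auto simp: powr_realpow[symmetric] of_nat_diff\<close>)
  finally have "beta_tail k j 0 = Beta (real (j + 1)) (real k)"
    unfolding beta_tail_def by (intro integral_unique) (simp add: has_integral_Icc_iff_Ioo)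
  also have "\<dots> = fact j * fact (k - 1) / fact (j + k)"
  proof -
    have "real (j + 1) = 1 + real j" "real k = 1 + real (k - 1)" "real (j + 1) + real k = 1 + real (j + k)"
      using assms by auto
    then show ?thesis unfolding Beta_def by (metis Gamma_fact)
  qed
  also have "\<dots> = 1 / (k * real ((j + k) choose k))"
    using assms fact_reduce[of k, where 'a = real] binomial_fact[of k "j + k", where 'a = real]
    by (simp add: field_simps)
  finally show ?thesis .
qed

text \<open>On \<open>{s..1}\<close> the factor \<open>t ^ j\<close> lies between
  \<open>s ^ j\<close> and 1; the remaining power of \<open>1 - t\<close> integrates
  exactly.\<close>

lemma beta_tail_bounds:
  assumes "k \<ge> 1" "0 \<le> s" "s \<le> 1"
  shows "beta_tail k j s \<le> (1 - s) ^ k / k" "s ^ j * ((1 - s) ^ k / k) \<le> beta_tail k j s"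
proof -
  have i: "integral {s..1} (\<lambda>t. (1 - t) ^ (k - 1)) = (1 - s) ^ k / k"
    "(\<lambda>t. (1 - t) ^ (k - 1)) integrable_on {s..1}"
    using integral_one_minus_power[OF assms(3,1)] by (auto simp: integral_unique)
  show "beta_tail k j s \<le> (1 - s) ^ k / k"
    unfolding beta_tail_def i(1)[symmetric]
    by (intro integral_le beta_integrand_integrable i)
      (use assms in \<open>auto intro!: mult_left_le_one_le power_le_one\<close>)
  have "s ^ j * ((1 - s) ^ k / k) = integral {s..1} (\<lambda>t. s ^ j * (1 - t) ^ (k - 1))"
    by (simp add: i(1) del: One_nat_def)
  also have "\<dots> \<le> beta_tail k j s"
    unfolding beta_tail_def
    by (intro integral_le beta_integrand_integrable integrable_continuous_interval continuous_intros)
      (use assms in \<open>auto intro!: mult_right_mono power_mono\<close>)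
  finally show "s ^ j * ((1 - s) ^ k / k) \<le> beta_tail k j s" .
qed

text \<open>The one-eigenvalue factor of the density combined with the event of modulus at most
  \<open>r\<close>. Keeping \<open>r\<close> as a parameter lets one formula serve both the
  probability and, at \<open>r = 1\<close>, the normalisation; \<open>y < 1\<close> mirrors the open
  disc of the density.\<close>

definition disc_weight :: "nat \<Rightarrow> real \<Rightarrow> real \<Rightarrow> real" where
  "disc_weight k r y = (if y \<le> r \<and> y < 1 then (1 - y\<^sup>2) ^ (k - 1) else 0)"

lemma disc_weight_measurable [measurable]: "disc_weight k r \<in> borel_measurable borel"
  unfolding disc_weight_def[abs_def] by measurable

lemma disc_weight_integrable:
  "integrable lborel (\<lambda>z::complex. cmod z ^ m * disc_weight k r (cmod z))"
proof (rule Bochner_Integration.integrable_bound)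
  show "integrable lborel (\<lambda>z::complex. indicator (cball 0 1) z :: real)"
    by (simp add: emeasure_cball)
  show "AE z in lborel. norm (cmod z ^ m * disc_weight k r (cmod z)) \<le> norm (indicator (cball 0 1) z :: real)"
  proof (intro AE_I2)
    fix z :: complex
    show "norm (cmod z ^ m * disc_weight k r (cmod z)) \<le> norm (indicator (cball 0 1) z :: real)"
    proof (cases "cmod z < 1")
      case True
      then have "(cmod z)\<^sup>2 \<le> 1" by (simp add: power_le_one)
      then have "\<bar>1 - (cmod z)\<^sup>2\<bar> ^ (k - 1) \<le> 1" by (intro power_le_one) auto
      then have "\<bar>disc_weight k r (cmod z)\<bar> \<le> 1" by (simp add: disc_weight_def power_abs)
      moreover have "cmod z ^ m \<le> 1" using True by (intro power_le_one) auto
      ultimately show ?thesis using True by (simp add: abs_mult mult_le_one)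
    next
      case False
      then show ?thesis by (simp add: disc_weight_def)
    qed
  qed
qed measurable

lemma disc_weight_moment:
  assumes "0 \<le> r" "r \<le> 1"
  shows "(LINT z|(lborel :: complex measure). cmod z ^ (2 * j) * disc_weight k r (cmod z)) =
    pi * (beta_tail k j 0 - beta_tail k j (r\<^sup>2))"
proof -
  define f :: "real \<Rightarrow> real" where "f t = t ^ j * (1 - t) ^ (k - 1)" for t
  define h where "h t = (if t \<le> r\<^sup>2 \<and> t < 1 then f t else 0)" for t
  have [measurable]: "h \<in> borel_measurable borel"
    unfolding h_def[abs_def] f_def by measurable
  have r2: "r\<^sup>2 \<le> 1" using assms by (simp add: power_le_one)
  have "cmod z ^ (2 * j) * disc_weight k r (cmod z) = h ((cmod z)\<^sup>2)" for z :: complex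
  proof -
    have "(cmod z)\<^sup>2 \<le> r\<^sup>2 \<longleftrightarrow> cmod z \<le> r" using assms(1) by (intro power_mono_iff) auto
    moreover have "(cmod z)\<^sup>2 < 1 \<longleftrightarrow> cmod z < 1" using power_less_one_iff[of "cmod z" 2] by simp
    ultimately show ?thesis by (simp add: h_def f_def disc_weight_def power_mult)
  qed
  then have "(LINT z|(lborel :: complex measure). cmod z ^ (2 * j) * disc_weight k r (cmod z)) =
    pi * (LINT t:{0..}|lborel. h t)"
    by (simp add: integral_norm_sq)
  also have "(LINT t:{0..}|lborel. h t) = (LINT t:{0..r\<^sup>2}|lborel. f t)"
    unfolding set_lebesgue_integral_def
  proof (rule integral_cong_AE)
    \<comment> \<open>The two integrands can differ only at t = 1, and only when
      \<open>r = 1\<close>.\<close>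
    show "AE t in lborel. indicat_real {0..} t *\<^sub>R h t = indicat_real {0..r\<^sup>2} t *\<^sub>R f t"
      using AE_lborel_singleton[of "1::real"]
      by eventually_elim (use r2 in \<open>auto simp: h_def indicator_def\<close>)
  qed (auto simp: f_def)
  also have "\<dots> = integral {0..r\<^sup>2} f"
    by (intro set_borel_integral_eq_integral borel_integrable_atLeastAtMost')
      (auto simp: f_def intro!: continuous_intros)
  also have "\<dots> = beta_tail k j 0 - beta_tail k j (r\<^sup>2)"
    using Henstock_Kurzweil_Integration.integral_combine[of 0 "r\<^sup>2" 1 f] r2 beta_integrand_integrable[of j k 0 1]
    unfolding beta_tail_def f_def by simp
  finally show ?thesis .
qed

section \<open>Asymptotics of the product\<close>

text \<open>Apply 1 + y \<le> exp y with y = -q for the upper bound and with y = q / (1 - q) for the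
  lower one. With S the sum of the q, the product lies between exp (-S / (1 - \<delta>)) and exp
  (-S).\<close>

lemma prod_one_minus_tendsto_exp:
  fixes q :: "nat \<Rightarrow> nat \<Rightarrow> real"
  assumes q: "eventually (\<lambda>n. \<forall>j<p n. 0 \<le> q n j \<and> q n j \<le> \<delta> n) sequentially"
    and \<delta>: "\<delta> \<longlonglongrightarrow> 0"
    and sum: "(\<lambda>n. \<Sum>j<p n. q n j) \<longlonglongrightarrow> L"
  shows "(\<lambda>n. \<Prod>j<p n. 1 - q n j) \<longlonglongrightarrow> exp (- L)"
proof (rule tendsto_sandwich)
  have small: "eventually (\<lambda>n. \<delta> n < 1) sequentially"
    by (rule order_tendstoD(2)[OF \<delta>]) simp
  show "eventually (\<lambda>n. (\<Prod>j<p n. 1 - q n j) \<le> exp (- (\<Sum>j<p n. q n j))) sequentially"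
    using q small
  proof eventually_elim
    case (elim n)
    have "(\<Prod>j<p n. 1 - q n j) \<le> (\<Prod>j<p n. exp (- q n j))"
    proof (intro prod_mono conjI)
      fix j assume "j \<in> {..<p n}"
      then have "0 \<le> q n j" "q n j \<le> \<delta> n" using elim by auto
      then show "0 \<le> 1 - q n j" using elim by simp
      show "1 - q n j \<le> exp (- q n j)" using exp_ge_add_one_self[of "- q n j"] by simp
    qed
    then show ?case by (simp add: exp_sum[symmetric] sum_negf)
  qed
  show "eventually (\<lambda>n. exp (- ((\<Sum>j<p n. q n j) / (1 - \<delta> n))) \<le> (\<Prod>j<p n. 1 - q n j)) sequentially"
    using q small
  proof eventually_elim
    case (elim n)
    have "(\<Prod>j<p n. exp (- (q n j / (1 - \<delta> n)))) \<le> (\<Prod>j<p n. 1 - q n j)"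
    proof (intro prod_mono conjI)
      fix j assume "j \<in> {..<p n}"
      then have j: "0 \<le> q n j" "q n j \<le> \<delta> n" using elim by auto
      have "1 / (1 - q n j) = 1 + q n j / (1 - q n j)" using j elim by (simp add: field_simps)
      also have "\<dots> \<le> exp (q n j / (1 - q n j))" by (rule exp_ge_add_one_self)
      also have "\<dots> \<le> exp (q n j / (1 - \<delta> n))"
        using j elim by (auto intro!: divide_left_mono mult_pos_pos)
      finally show "exp (- (q n j / (1 - \<delta> n))) \<le> 1 - q n j"
        using j elim by (simp add: exp_minus field_simps)
    qed simp
    then show ?case by (simp add: exp_sum[symmetric] sum_negf sum_divide_distrib)
  qed
  show "(\<lambda>n. exp (- (\<Sum>j<p n. q n j))) \<longlonglongrightarrow> exp (- L)"
    by (intro tendsto_intros sum)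
  have "(\<lambda>n. exp (- ((\<Sum>j<p n. q n j) / (1 - \<delta> n)))) \<longlonglongrightarrow> exp (- (L / (1 - 0)))"
    by (intro tendsto_intros sum \<delta>) simp
  then show "(\<lambda>n. exp (- ((\<Sum>j<p n. q n j) / (1 - \<delta> n)))) \<longlonglongrightarrow> exp (- L)"
    by simp
qed

text \<open>For n > 0 the quotient is the product of the m factors 1 - i / n, each tending to
  1.\<close>

lemma binomial_over_power_tendsto:
  "(\<lambda>n. real (n choose m) * fact m / real n ^ m) \<longlonglongrightarrow> 1"
proof -
  have "(\<lambda>n. \<Prod>i = 0..<m. 1 - real i / real n) \<longlonglongrightarrow> (\<Prod>i = 0..<m. 1 - 0)"
    by (intro tendsto_intros lim_const_over_n)
  moreover have "eventually (\<lambda>n. (\<Prod>i = 0..<m. 1 - real i / real n) = real (n choose m) * fact m / real n ^ m) sequentially"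
    using eventually_gt_at_top[of 0]
  proof eventually_elim
    case (elim n)
    have "(\<Prod>i = 0..<m. 1 - real i / real n) = (\<Prod>i = 0..<m. (real n - real i) / real n)"
      using elim by (simp add: field_simps)
    also have "\<dots> = (\<Prod>i = 0..<m. real n - real i) / real n ^ m"
      by (simp add: prod_dividef)
    also have "(\<Prod>i = 0..<m. real n - real i) = real (n choose m) * fact m"
      by (simp add: binomial_gbinomial gbinomial_prod_rev)
    finally show ?case .
  qed
  ultimately show ?thesis by (simp add: tendsto_cong)
qed

text \<open>The hockey-stick identity, by Pascal's rule; used at \<open>p = n - k\<close>.\<close>

lemma sum_binomial_diagonal: "(\<Sum>j<p. (j + k) choose k) = (p + k) choose (k + 1)"
  by (induction p) (simp_all add: binomial_eq_0)

text \<open>The tails enter only through their two bounds, which differ by the factor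
  \<open>s n ^ j\<close>; since n (1 - s n) tends to 0, this factor tends to 1 uniformly in j <
  n.\<close>

lemma prod_tail_tendsto:
  fixes x :: real and q :: "nat \<Rightarrow> nat \<Rightarrow> real"
  assumes k: "k \<ge> 1" and x: "x \<le> 0"
  defines "a \<equiv> (\<lambda>n. 2 * real n powr (1 + 1 / real k) / (fact (k + 1)) powr (1 / real k))"
  defines "s \<equiv> (\<lambda>n. (1 + x / a n)\<^sup>2)"
  assumes q: "\<And>n j. 0 \<le> s n \<Longrightarrow> s n \<le> 1 \<Longrightarrow> q n j \<le> real ((j + k) choose k) * (1 - s n) ^ k"
    "\<And>n j. 0 \<le> s n \<Longrightarrow> s n \<le> 1 \<Longrightarrow> real ((j + k) choose k) * (s n ^ j * (1 - s n) ^ k) \<le> q n j"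
  shows "(\<lambda>n. \<Prod>j<n - k. 1 - q n j) \<longlonglongrightarrow> exp (- ((- x) ^ k))"
proof -
  define c :: real where "c = (fact (k + 1)) powr (1 / real k)"
  have c: "c > 0" "c ^ k = fact (k + 1)"
  proof -
    show "c > 0" by (simp add: c_def)
    have "c ^ k = c powr real k" using \<open>c > 0\<close> by (simp add: powr_realpow)
    also have "\<dots> = fact (k + 1)" using k unfolding c_def by (subst powr_powr) simp
    finally show "c ^ k = fact (k + 1)" .
  qed
  have a_eq: "a n = 2 * real n * (real n powr (1 / real k)) / c" if "n > 0" for n
    using that by (simp add: a_def c_def powr_add)
  have a_pos: "a n > 0" if "n > 0" for n using that c by (simp add: a_eq)
  \<comment> \<open>This identity is the purpose of the normalisation: it cancels the growth of
    \<open>n choose (k + 1)\<close> and leaves the factor 2^k for the squared radius.\<close>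
  have a_pow: "a n ^ k = 2 ^ k * real n ^ (k + 1) / fact (k + 1)" if "n > 0" for n
  proof -
    have "(real n powr (1 / real k)) ^ k = real n"
      using that k by (simp add: powr_power)
    then show ?thesis unfolding a_eq[OF that] power_divide power_mult_distrib c(2) by simp
  qed
  \<comment> \<open>The ratio decays like n^(-1/k). It controls \<open>real n * e n\<close>, hence
    both the uniform smallness of the tails and the Bernoulli error.\<close>
  have n_over_a: "(\<lambda>n. real n / a n) \<longlonglongrightarrow> 0"
  proof -
    have "filterlim (\<lambda>n. real n powr (1 / real k)) at_top sequentially"
      using k by (intro filterlim_compose[OF real_powr_at_top filterlim_real_sequentially]) auto
    then have "(\<lambda>n. (c / 2) / (real n powr (1 / real k))) \<longlonglongrightarrow> 0"
      by (rule real_tendsto_divide_at_top[OF tendsto_const])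
    moreover have "eventually (\<lambda>n. (c / 2) / (real n powr (1 / real k)) = real n / a n) sequentially"
      using eventually_gt_at_top[of 0] by eventually_elim (simp add: a_eq)
    ultimately show ?thesis by (rule Lim_transform_eventually)
  qed
  have inv_a: "(\<lambda>n. 1 / a n) \<longlonglongrightarrow> 0"
  proof -
    have "(\<lambda>n. (real n / a n) * (1 / real n)) \<longlonglongrightarrow> 0 * 0"
      by (intro tendsto_mult n_over_a lim_const_over_n)
    moreover have "eventually (\<lambda>n. (real n / a n) * (1 / real n) = 1 / a n) sequentially"
      using eventually_gt_at_top[of 0] by eventually_elim simp
    ultimately show ?thesis using Lim_transform_eventually by fastforce
  qed
  define e where "e n = 1 - s n" for n
  have e_eq: "e n = (1 / a n) * ((- x) * (2 + x * (1 / a n)))" for n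
    by (simp add: e_def s_def power2_eq_square algebra_simps add_divide_distrib)
  have s_range: "eventually (\<lambda>n. 0 \<le> s n \<and> s n \<le> 1) sequentially"
  proof -
    have "(\<lambda>n. 1 + x * (1 / a n)) \<longlonglongrightarrow> 1 + x * 0" by (intro tendsto_intros inv_a)
    then have "eventually (\<lambda>n. 1 + x * (1 / a n) > 0) sequentially"
      by (intro order_tendstoD(1)) auto
    then show ?thesis using eventually_gt_at_top[of 0]
    proof eventually_elim
      case (elim n)
      have "x / a n \<le> 0" using x a_pos[OF elim(2)] by (simp add: divide_nonpos_pos)
      then show ?case using elim unfolding s_def by (auto intro!: power_le_one)
    qed
  qed
  have ne: "(\<lambda>n. real n * e n) \<longlonglongrightarrow> 0"
  proof -
    have "(\<lambda>n. (real n / a n) * ((- x) * (2 + x * (1 / a n)))) \<longlonglongrightarrow> 0 * ((- x) * (2 + x * 0))"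
      by (intro tendsto_intros n_over_a inv_a)
    then show ?thesis by (simp add: e_eq)
  qed
  have main: "(\<lambda>n. real (n choose (k + 1)) * e n ^ k) \<longlonglongrightarrow> (- x) ^ k"
  proof -
    have "(\<lambda>n. (real (n choose (k + 1)) * fact (k + 1) / real n ^ (k + 1)) * ((- x) * (2 + x * (1 / a n))) ^ k / 2 ^ k)
      \<longlonglongrightarrow> 1 * ((- x) * (2 + x * 0)) ^ k / 2 ^ k"
      by (intro tendsto_intros binomial_over_power_tendsto inv_a) simp
    also have "1 * ((- x) * (2 + x * 0)) ^ k / 2 ^ k = (- x) ^ k" unfolding power_mult_distrib by simp
    finally show ?thesis
    proof (rule Lim_transform_eventually)
      show "eventually (\<lambda>n. (real (n choose (k + 1)) * fact (k + 1) / real n ^ (k + 1)) * ((- x) * (2 + x * (1 / a n))) ^ k / 2 ^ k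
        = real (n choose (k + 1)) * e n ^ k) sequentially"
        using eventually_gt_at_top[of 0]
        by eventually_elim (unfold e_eq power_mult_distrib[of "1 / a n" for n] power_divide a_pow, simp add: mult_ac)
    qed
  qed
  show ?thesis
  \<comment> \<open>For \<open>j < n - k\<close> the binomial coefficient is at most n^k, so each
    tail is at most (n e)^k, which tends to 0 because \<open>k \<ge> 1\<close>.\<close>
  proof (rule prod_one_minus_tendsto_exp[where \<delta> = "\<lambda>n. (real n * e n) ^ k"])
    show "eventually (\<lambda>n. \<forall>j<n - k. 0 \<le> q n j \<and> q n j \<le> (real n * e n) ^ k) sequentially"
      using s_range
    proof eventually_elim
      case (elim n)
      show ?case
      proof (intro allI impI conjI)
        fix j assume j: "j < n - k"
        have "0 \<le> real ((j + k) choose k) * (s n ^ j * (1 - s n) ^ k)" using elim by simp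
        also have "\<dots> \<le> q n j" using elim by (intro q) auto
        finally show "0 \<le> q n j" .
        have "(j + k) choose k \<le> (j + k) ^ k"
          by (rule binomial_le_pow) simp 
        also have "\<dots> \<le> n ^ k" using j by (intro power_mono) auto
        finally have "real ((j + k) choose k) \<le> real n ^ k"
          by (metis of_nat_le_iff of_nat_power)
        moreover have "q n j \<le> real ((j + k) choose k) * e n ^ k"
          using elim unfolding e_def by (intro q) auto
        moreover have "0 \<le> e n ^ k" using elim by (simp add: e_def)
        ultimately show "q n j \<le> (real n * e n) ^ k"
          unfolding power_mult_distrib by (meson mult_right_mono order_trans)
      qed
    qed
    show "(\<lambda>n. (real n * e n) ^ k) \<longlonglongrightarrow> 0"
      using tendsto_power[OF ne, of k] k by (simp add: power_0_left)
    have sum_eq: "(\<Sum>j<n - k. real ((j + k) choose k)) = real (n choose (k + 1))" if "n > k" for n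
      using sum_binomial_diagonal[of k "n - k"] that by (metis of_nat_sum le_add_diff_inverse2 less_imp_le)
    show "(\<lambda>n. \<Sum>j<n - k. q n j) \<longlonglongrightarrow> (- x) ^ k"
    proof (rule tendsto_sandwich[OF _ _ _ main])
      show "eventually (\<lambda>n. (\<Sum>j<n - k. q n j) \<le> real (n choose (k + 1)) * e n ^ k) sequentially"
        using s_range eventually_gt_at_top[of k]
      proof eventually_elim
        case (elim n)
        have "(\<Sum>j<n - k. q n j) \<le> (\<Sum>j<n - k. real ((j + k) choose k) * e n ^ k)"
          using elim unfolding e_def by (intro sum_mono q) auto
        then show ?case using elim by (simp add: sum_distrib_right[symmetric] sum_eq)
      qed
      show "eventually (\<lambda>n. (1 - real n * e n) * (real (n choose (k + 1)) * e n ^ k) \<le> (\<Sum>j<n - k. q n j)) sequentially"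
        using s_range eventually_gt_at_top[of k]
      proof eventually_elim
        case (elim n)
        have "0 \<le> e n ^ k" using elim by (simp add: e_def)
        have "(1 - real n * e n) * (real (n choose (k + 1)) * e n ^ k)
          = (\<Sum>j<n - k. real ((j + k) choose k) * ((1 - real n * e n) * e n ^ k))"
          using elim by (simp add: sum_distrib_right[symmetric] sum_eq)
        also have "\<dots> \<le> (\<Sum>j<n - k. real ((j + k) choose k) * (s n ^ j * e n ^ k))"
        proof (intro sum_mono mult_left_mono mult_right_mono)
          fix j assume "j \<in> {..<n - k}"
          \<comment> \<open>Bernoulli's inequality gives a bound uniform in j, so the whole sum
            loses only one common factor.\<close>
          have "1 - real n * e n \<le> (1 - e n) ^ n"
            using Bernoulli_inequality[of "- e n" n] elim by (simp add: e_def algebra_simps)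
          also have "\<dots> \<le> s n ^ j"
            using elim \<open>j \<in> _\<close> unfolding e_def by (auto intro!: power_decreasing)
          finally show "1 - real n * e n \<le> s n ^ j" .
        qed (use \<open>0 \<le> e n ^ k\<close> in auto)
        also have "\<dots> \<le> (\<Sum>j<n - k. q n j)"
          using elim unfolding e_def by (intro sum_mono q) auto
        finally show ?case .
      qed
      have "(\<lambda>n. (1 - real n * e n) * (real (n choose (k + 1)) * e n ^ k)) \<longlonglongrightarrow> (1 - 0) * (- x) ^ k"
        by (intro tendsto_intros ne main)
      then show "(\<lambda>n. (1 - real n * e n) * (real (n choose (k + 1)) * e n ^ k)) \<longlonglongrightarrow> (- x) ^ k"
        by simp
    qed
  qed
qed

section \<open>From the joint density to the probability of a disc\<close>

text \<open>The event is invariant under permuting coordinates, so its preimage under the relabelled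
  vector is a rectangle \<open>E \<times> S\<close> whose second factor has mass 1.\<close>

lemma (in prob_space) unordered_joint_density_prob:
  assumes Z: "\<And>j. j \<in> {1..p} \<Longrightarrow> Z j \<in> borel_measurable M"
    and density: "has_unordered_joint_density M p Z f"
    and B: "B \<in> sets borel"
  shows "emeasure M {\<omega> \<in> space M. \<forall>j\<in>{1..p}. Z j \<omega> \<in> B} =
    (\<integral>\<^sup>+x. ennreal (f x) * indicator {x. \<forall>j\<in>{1..p}. x j \<in> B} x \<partial>(\<Pi>\<^sub>M j\<in>{1..p}. lborel))"
proof -
  define S where "S = {s. s permutes {1..p}}"
  define N where "N = M \<Otimes>\<^sub>M uniform_count_measure S"
  define P where "P = (\<Pi>\<^sub>M j\<in>{1..p}. (lborel :: complex measure))"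
  define X where "X = (\<lambda>(\<omega>, s). \<lambda>j\<in>{1..p}. Z (s j) \<omega>)"
  define A where "A = {x \<in> space P. \<forall>j\<in>{1..p}. x j \<in> B}"
  have S: "finite S" "S \<noteq> {}"
    using permutes_id[of "{1..p}"] unfolding S_def by (blast intro: finite_permutations)+
  interpret S: prob_space "uniform_count_measure S"
    by (rule prob_space_uniform_count_measure[OF S])
  have dist: "distributed N P X (\<lambda>x. ennreal (f x))"
    using density unfolding has_unordered_joint_density_def N_def P_def X_def S_def .
  note [measurable] = B
  have [measurable]: "A \<in> sets P"
    unfolding A_def P_def by measurable
  define E where "E = {\<omega> \<in> space M. \<forall>j\<in>{1..p}. Z j \<omega> \<in> B}"
  have E: "E \<in> sets M"
    unfolding E_def using Z by measurable
  have "X -` A \<inter> space N = E \<times> S"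
  proof (intro equalityI subsetI)
    fix w assume "w \<in> X -` A \<inter> space N"
    then obtain \<omega> s where w: "w = (\<omega>, s)" "\<omega> \<in> space M" "s \<in> S" "X (\<omega>, s) \<in> A"
      by (cases w) (auto simp: N_def space_pair_measure space_uniform_count_measure)
    have "Z j \<omega> \<in> B" if "j \<in> {1..p}" for j
    proof -
      from w(3) have s: "s permutes {1..p}" by (simp add: S_def)
      \<comment> \<open>The value \<open>Z j \<omega>\<close> sits in coordinate
        \<open>inv s j\<close> of the relabelled vector.\<close>
      have "Hilbert_Choice.inv s j \<in> {1..p}" using permutes_in_image[OF permutes_inv[OF s]] that by blast
      moreover have "s (Hilbert_Choice.inv s j) = j" using permutes_inverses(1)[OF s] .
      ultimately show ?thesis using w(4) by (force simp: X_def A_def)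
    qed
    then show "w \<in> E \<times> S" using w by (simp add: E_def)
  next
    fix w assume "w \<in> E \<times> S"
    then obtain \<omega> s where w: "w = (\<omega>, s)" "\<omega> \<in> E" "s \<in> S" by auto
    have "s j \<in> {1..p}" if "j \<in> {1..p}" for j
      using w(3) permutes_in_image[of s "{1..p}" j] that by (simp add: S_def)
    then show "w \<in> X -` A \<inter> space N"
      using w by (auto simp: X_def A_def P_def N_def E_def space_PiM space_pair_measure space_uniform_count_measure)
  qed
  then have "emeasure (distr N P X) A = emeasure N (E \<times> S)"
    using distributed_measurable[OF dist] by (simp add: emeasure_distr)
  also have "\<dots> = emeasure M E * emeasure (uniform_count_measure S) S"
    unfolding N_def using E S by (intro S.emeasure_pair_measure_Times) (auto simp: sets_uniform_count_measure)
  also have "\<dots> = emeasure M E"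
    using S.emeasure_space_1 by (simp add: space_uniform_count_measure)
  finally have "emeasure M E = (\<integral>\<^sup>+x. ennreal (f x) * indicator A x \<partial>P)"
    unfolding distributed_distr_eq_density[OF dist]
    using distributed_borel_measurable[OF dist] by (simp add: emeasure_density)
  also have "\<dots> = (\<integral>\<^sup>+x. ennreal (f x) * indicator {x. \<forall>j\<in>{1..p}. x j \<in> B} x \<partial>P)"
    by (intro nn_integral_cong) (simp add: A_def indicator_def)
  finally show ?thesis unfolding E_def P_def .
qed

text \<open>The probability is \<open>C * I r\<close> and the total mass is
  \<open>C * I 1 = 1\<close>, so it equals \<open>I r / I 1\<close>; the tails at 1 vanish, leaving
  complete Beta integrals in the denominator.\<close>

lemma (in prob_space) prob_all_norm_le:
  assumes Z: "\<And>j. j \<in> {1..p} \<Longrightarrow> Z j \<in> borel_measurable M"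
    and density: "has_unordered_joint_density M p Z (\<lambda>x. C * truncated_unitary_weight n p x)"
    and k: "k \<ge> 1" and n: "n = p + k" and r: "0 \<le> r" "r \<le> 1"
  shows "prob {\<omega> \<in> space M. \<forall>j\<in>{1..p}. cmod (Z j \<omega>) \<le> r} =
    (\<Prod>j<p. 1 - beta_tail k j (r\<^sup>2) / beta_tail k j 0)"
proof -
  define P where "P = (\<Pi>\<^sub>M j\<in>{1..p}. (lborel :: complex measure))"
  define w where "w r x = (\<Prod>j\<in>{1..p}. \<Prod>i\<in>{1..<j}. (cmod (x i - x j))\<^sup>2) * (\<Prod>j\<in>{1..p}. disc_weight k r (cmod (x j)))"
    for r and x :: "nat \<Rightarrow> complex"
  define I where "I r = (LINT x|P. w r x)" for r
  have w_nonneg: "0 \<le> w r x" for r x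
    unfolding w_def disc_weight_def
    by (intro mult_nonneg_nonneg prod_nonneg) (auto intro!: zero_le_power simp: power_le_one)
  have integrable_w: "integrable P (w r)" for r
    unfolding P_def w_def by (intro vandermonde_radial_integral disc_weight_integrable) measurable
  have I_eq: "I r = fact p * (\<Prod>j<p. pi * (beta_tail k j 0 - beta_tail k j (r\<^sup>2)))" if "0 \<le> r" "r \<le> 1" for r
    unfolding I_def P_def w_def
    by (subst vandermonde_radial_integral) (auto intro!: disc_weight_integrable simp: disc_weight_moment that)
  \<comment> \<open>Support and event both factor over the coordinates, so density times event is
    again a product weight; with \<open>n = p + k\<close> the exponent is
    \<open>k - 1\<close>.\<close>
  have weight: "truncated_unitary_weight n p x * indicator {x. \<forall>j\<in>{1..p}. x j \<in> cball 0 r} x = w r x"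
    if "r \<le> 1" for r x
  proof (cases "\<forall>j\<in>{1..p}. cmod (x j) \<le> r \<and> cmod (x j) < 1")
    case True
    then show ?thesis
      by (simp add: truncated_unitary_weight_def w_def disc_weight_def n indicator_def)
  next
    case False
    then have "w r x = 0" by (auto simp: w_def disc_weight_def intro!: prod_zero)
    then show ?thesis using False by (auto simp: truncated_unitary_weight_def indicator_def)
  qed
  have prob_ennreal: "emeasure M {\<omega> \<in> space M. \<forall>j\<in>{1..p}. Z j \<omega> \<in> cball 0 r} = (\<integral>\<^sup>+x. ennreal (C * w r x) \<partial>P)"
    if "r \<le> 1" for r
  proof -
    have "emeasure M {\<omega> \<in> space M. \<forall>j\<in>{1..p}. Z j \<omega> \<in> cball 0 r} =
      (\<integral>\<^sup>+x. ennreal (C * truncated_unitary_weight n p x) * indicator {x. \<forall>j\<in>{1..p}. x j \<in> cball 0 r} x \<partial>P)"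
      unfolding P_def by (rule unordered_joint_density_prob[OF Z density]) auto
    also have "\<dots> = (\<integral>\<^sup>+x. ennreal (C * w r x) \<partial>P)"
      by (intro nn_integral_cong) (simp add: weight[OF that, symmetric] indicator_def)
    finally show ?thesis .
  qed
  have total: "(\<integral>\<^sup>+x. ennreal (C * w 1 x) \<partial>P) = 1"
  proof -
    have eq: "C * truncated_unitary_weight n p x = C * w 1 x" for x
      by (auto simp: weight[of 1, symmetric] truncated_unitary_weight_def indicator_def less_imp_le)
    then show ?thesis
      using unordered_joint_density_prob[OF Z density, of UNIV] emeasure_space_1
      unfolding eq by (simp add: P_def)
  qed
  \<comment> \<open>The sign of \<open>C\<close> has to be derived: \<open>ennreal\<close> truncates
    negative reals to 0, so a negative \<open>C\<close> would give total mass 0.\<close>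
  have "C \<ge> 0"
  proof (rule ccontr)
    assume "\<not> C \<ge> 0"
    then have "ennreal (C * w 1 x) = 0" for x
      using w_nonneg by (simp add: ennreal_neg mult_nonpos_nonneg)
    then show False using total by simp
  qed
  have nn: "(\<integral>\<^sup>+x. ennreal (C * w r x) \<partial>P) = ennreal (C * I r)" for r
    using \<open>C \<ge> 0\<close> w_nonneg integrable_w unfolding I_def
    by (subst nn_integral_eq_integral) auto
  have "C * I 1 = 1"
    using total unfolding nn by (simp add: ennreal_eq_1)
  have "prob {\<omega> \<in> space M. \<forall>j\<in>{1..p}. cmod (Z j \<omega>) \<le> r} = C * I r"
  proof -
    have "0 \<le> I r" unfolding I_def using w_nonneg by (intro Bochner_Integration.integral_nonneg) auto
    then show ?thesis
      using prob_ennreal[OF r(2)] \<open>C \<ge> 0\<close> unfolding nn by (simp add: measure_def)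
  qed
  also have "\<dots> = I r / I 1"
    using \<open>C * I 1 = 1\<close> by (cases "I 1 = 0") (simp_all add: eq_divide_eq mult_ac)
  also have "\<dots> = (\<Prod>j<p. (beta_tail k j 0 - beta_tail k j (r\<^sup>2)) / beta_tail k j 0)"
    using r by (simp add: I_eq prod_dividef[symmetric] prod.distrib beta_tail_def)
  also have "\<dots> = (\<Prod>j<p. 1 - beta_tail k j (r\<^sup>2) / beta_tail k j 0)"
  proof (intro prod.cong refl)
    fix j
    have "beta_tail k j 0 \<noteq> 0" using k by (simp add: beta_tail_0)
    then show "(beta_tail k j 0 - beta_tail k j (r\<^sup>2)) / beta_tail k j 0 = 1 - beta_tail k j (r\<^sup>2) / beta_tail k j 0"
      by (simp add: diff_divide_distrib)
  qed
  finally show ?thesis .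
qed

section \<open>Convergence of the distribution functions\<close>

theorem theorem4:
  fixes k :: nat
    and M :: "nat \<Rightarrow> 'a measure"
    and U :: "nat \<Rightarrow> 'a \<Rightarrow> complex mat"
    and z :: "nat \<Rightarrow> nat \<Rightarrow> 'a \<Rightarrow> complex"
    and C :: "nat \<Rightarrow> real"
    and p :: "nat \<Rightarrow> nat"
  assumes "k \<ge> 1"
    and "\<And>n. n > k \<Longrightarrow> p n = n - k"
    and "\<And>n. n > k \<Longrightarrow> prob_space (M n)"
    and "\<And>n. n > k \<Longrightarrow> haar_distributed_unitary (M n) n (U n)"
    and "\<And>n j. n > k \<Longrightarrow> j \<in> {1..p n} \<Longrightarrow> z n j \<in> borel_measurable (M n)"
    and "\<And>n \<omega>. n > k \<Longrightarrow> \<omega> \<in> space (M n) \<Longrightarrow>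
           enumerates_eigenvalues (truncation (p n) (U n \<omega>)) (p n) (\<lambda>j. z n j \<omega>)"
    and "\<And>n. n > k \<Longrightarrow>
           has_unordered_joint_density (M n) (p n) (z n)
             (\<lambda>x. C n * truncated_unitary_weight n (p n) x)"
  shows "weak_conv
    (\<lambda>n. cdf (distr (M n) borel
       (\<lambda>\<omega>. 2 * real n powr (1 + 1 / real k) / (fact (k + 1)) powr (1 / real k)
              * (Max ((\<lambda>j. cmod (z n j \<omega>)) ` {1..p n}) - 1))))
    (reversed_weibull_cdf k)"
proof -
  define a :: "nat \<Rightarrow> real"
    where "a n = 2 * real n powr (1 + 1 / real k) / (fact (k + 1)) powr (1 / real k)" for n
  define D where "D n = distr (M n) borel (\<lambda>\<omega>. a n * (Max ((\<lambda>j. cmod (z n j \<omega>)) ` {1..p n}) - 1))" for n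
  define q where "q n j x = beta_tail k j ((1 + x / a n)\<^sup>2) / beta_tail k j 0" for n j x
  have a_pos: "a n > 0" if "n > k" for n using that by (simp add: a_def)
  have cdf_eq: "cdf (D n) x = measure (M n) {\<omega> \<in> space (M n). \<forall>j\<in>{1..p n}. cmod (z n j \<omega>) \<le> 1 + x / a n}"
    if n: "n > k" for n x
  proof -
    have [measurable]: "(\<lambda>\<omega>. Max ((\<lambda>j. cmod (z n j \<omega>)) ` {1..p n})) \<in> borel_measurable (M n)"
      using assms(5)[OF n] by (intro borel_measurable_Max) auto
    have meas: "(\<lambda>\<omega>. a n * (Max ((\<lambda>j. cmod (z n j \<omega>)) ` {1..p n}) - 1)) \<in> borel_measurable (M n)"
      by measurable
    have "cdf (D n) x = measure (M n) {\<omega> \<in> space (M n). a n * (Max ((\<lambda>j. cmod (z n j \<omega>)) ` {1..p n}) - 1) \<le> x}"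
      unfolding cdf_def D_def using meas by (subst measure_distr) (auto intro!: arg_cong[where f = "measure (M n)"])
    also have "{\<omega> \<in> space (M n). a n * (Max ((\<lambda>j. cmod (z n j \<omega>)) ` {1..p n}) - 1) \<le> x} =
      {\<omega> \<in> space (M n). \<forall>j\<in>{1..p n}. cmod (z n j \<omega>) \<le> 1 + x / a n}"
    proof (intro Collect_cong conj_cong refl)
      fix \<omega>
      \<comment> \<open>Since \<open>p n = n - k > 0\<close>, the maximum is over a nonempty
        set.\<close>
      have ne: "(\<lambda>j. cmod (z n j \<omega>)) ` {1..p n} \<noteq> {}" using n assms(2)[OF n] by auto
      have "a n * (Max ((\<lambda>j. cmod (z n j \<omega>)) ` {1..p n}) - 1) \<le> x \<longleftrightarrow>
        Max ((\<lambda>j. cmod (z n j \<omega>)) ` {1..p n}) \<le> 1 + x / a n"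
        using a_pos[OF n] by (simp add: field_simps)
      also have "\<dots> \<longleftrightarrow> (\<forall>j\<in>{1..p n}. cmod (z n j \<omega>) \<le> 1 + x / a n)"
        using ne by (subst Max_le_iff) auto
      finally show "a n * (Max ((\<lambda>j. cmod (z n j \<omega>)) ` {1..p n}) - 1) \<le> x \<longleftrightarrow>
        (\<forall>j\<in>{1..p n}. cmod (z n j \<omega>) \<le> 1 + x / a n)" .
    qed
    finally show ?thesis .
  qed
  have prob_eq: "measure (M n) {\<omega> \<in> space (M n). \<forall>j\<in>{1..p n}. cmod (z n j \<omega>) \<le> r} =
    (\<Prod>j<n - k. 1 - beta_tail k j (r\<^sup>2) / beta_tail k j 0)" if "n > k" "0 \<le> r" "r \<le> 1" for n r
    using prob_space.prob_all_norm_le[OF assms(3)[OF that(1)] assms(5)[OF that(1)] assms(7)[OF that(1)] assms(1) _ that(2,3)]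
      assms(2)[OF that(1)] that(1) by simp
  have "(\<lambda>n. cdf (D n) x) \<longlonglongrightarrow> reversed_weibull_cdf k x" for x
  proof (cases "x \<le> 0")
    case True
    have "(\<lambda>n. \<Prod>j<n - k. 1 - q n j x) \<longlonglongrightarrow> exp (- ((- x) ^ k))"
    proof (rule prod_tail_tendsto[OF assms(1) True], fold a_def)
      fix n j
      define s where "s = (1 + x / a n)\<^sup>2"
      assume s: "0 \<le> (1 + x / a n)\<^sup>2" "(1 + x / a n)\<^sup>2 \<le> 1"
      \<comment> \<open>Dividing by the complete Beta integral multiplies by k times the binomial
        coefficient; this k cancels the 1 / k in the tail bounds.\<close>
      have q_eq: "q n j x = beta_tail k j s * (k * real ((j + k) choose k))"
        using assms(1) by (simp add: q_def beta_tail_0 s_def)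
      note bounds = beta_tail_bounds[OF assms(1) s, of j, folded s_def]
      show "q n j x \<le> real ((j + k) choose k) * (1 - (1 + x / a n)\<^sup>2) ^ k"
        using mult_right_mono[OF bounds(1), of "k * real ((j + k) choose k)"] assms(1)
        unfolding q_eq s_def[symmetric] by (simp add: mult.commute)
      show "real ((j + k) choose k) * (((1 + x / a n)\<^sup>2) ^ j * (1 - (1 + x / a n)\<^sup>2) ^ k) \<le> q n j x"
        using mult_right_mono[OF bounds(2), of "k * real ((j + k) choose k)"] assms(1)
        unfolding q_eq s_def[symmetric] by (simp add: mult_ac)
    qed
    moreover have "eventually (\<lambda>n. (\<Prod>j<n - k. 1 - q n j x) = cdf (D n) x) sequentially"
    proof -
      \<comment> \<open>The product formula needs a radius in [0, 1], and \<open>1 + x / a n\<close>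
        is nonnegative only once \<open>a n \<ge> - x\<close>.\<close>
      have "filterlim a at_top sequentially"
      proof (rule filterlim_at_top_mono)
        show "filterlim (\<lambda>n. 2 / (fact (k + 1)) powr (1 / real k) * real n) at_top sequentially"
          by (intro filterlim_tendsto_pos_mult_at_top[OF tendsto_const] filterlim_real_sequentially) simp
        show "eventually (\<lambda>n. 2 / (fact (k + 1)) powr (1 / real k) * real n \<le> a n) sequentially"
          using eventually_gt_at_top[of 0]
        proof eventually_elim
          case (elim n)
          have "real n powr 1 \<le> real n powr (1 + 1 / real k)" using elim by (intro powr_mono) auto
          then show ?case using elim by (simp add: a_def divide_right_mono)
        qed
      qed
      then have "eventually (\<lambda>n. - x \<le> a n) sequentially"
        by (simp add: filterlim_at_top)
      then show ?thesis using eventually_gt_at_top[of k]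
      proof eventually_elim
        case (elim n)
        have "0 \<le> 1 + x / a n" "1 + x / a n \<le> 1"
          using elim a_pos[OF elim(2)] True by (simp_all add: field_simps)
        then show ?case unfolding cdf_eq[OF elim(2)] q_def by (intro prob_eq[symmetric] elim)
      qed
    qed
    ultimately have "(\<lambda>n. cdf (D n) x) \<longlonglongrightarrow> exp (- ((- x) ^ k))"
      by (rule Lim_transform_eventually)
    then show ?thesis using True by (simp add: reversed_weibull_cdf_def)
  next
    case False
    \<comment> \<open>For x > 0 the bound on the moduli exceeds 1, and the product formula at radius
      1 already gives probability 1, so the value is exact for every n > k.\<close>
    have "eventually (\<lambda>n. 1 = cdf (D n) x) sequentially"
      using eventually_gt_at_top[of k]
    proof eventually_elim
      case (elim n)
      interpret prob_space "M n" using assms(3)[OF elim] .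
      have [measurable]: "z n j \<in> borel_measurable (M n)" if "j \<in> {1..p n}" for j
        using assms(5)[OF elim that] .
      have "1 = prob {\<omega> \<in> space (M n). \<forall>j\<in>{1..p n}. cmod (z n j \<omega>) \<le> 1}"
        using prob_eq[OF elim, of 1] by (simp add: beta_tail_def)
      also have "\<dots> \<le> cdf (D n) x"
        unfolding cdf_eq[OF elim]
      proof (intro finite_measure_mono)
        have "0 \<le> x / a n" using False a_pos[OF elim] by simp
        then show "{\<omega> \<in> space (M n). \<forall>j\<in>{1..p n}. cmod (z n j \<omega>) \<le> 1}
          \<subseteq> {\<omega> \<in> space (M n). \<forall>j\<in>{1..p n}. cmod (z n j \<omega>) \<le> 1 + x / a n}"
          by force
      qed measurable
      finally show ?case unfolding cdf_eq[OF elim] using prob_le_1 by (simp add: antisym)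
    qed
    with tendsto_const[of 1 sequentially] have "(\<lambda>n. cdf (D n) x) \<longlonglongrightarrow> 1"
      by (rule Lim_transform_eventually)
    then show ?thesis using False by (simp add: reversed_weibull_cdf_def)
  qed
  then show ?thesis
    unfolding weak_conv_def D_def a_def by blast
qed

end
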